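(* Let $\mathcal{C},\mathcal{D},\mathcal{E}$ be small connected categories and let $F,G\colon\mathcal{C}\to\mathcal{D}$ and $H\colon\mathcal{E}\to\mathcal{C}$ be functors. Then $$\mathrm{cD}(F\circ H,G\circ H)\le \mathrm{cD}(F,G).$$
   Context: Interval category: for $m\ge 0$, $\mathcal{I}_m$ has objects $0,1,\dots,m$ and its only non-identity arrows are: exactly one arrow $r\to s$ whenever $r$ is even and $s=r-1$ or $s=r+1$. Two functors $F,G\colon\mathcal{C}\to\mathcal{D}$ between small categories are homotopic, $F\simeq G$, if for some $m\ge 0$ there is a functor $H\colon\mathcal{C}\times\mathcal{I}_m\to\mathcal{D}$ with $H_0=F$ and $H_m=G$ (equivalently, $F$ and $G$ are joined by a finite zigzag of natural transformations). A small category is connected if any two objects are joined by a finite zigzag of arrows. Members of covers (subcategories) are not required to be connected. Geometric cover: a collection $\{\mathcal{U}_\lambda\}_{\lambda\in\Lambda}$ of subcategories of $\mathcal{C}$ such that for every sequence of composable arrows $f_1,\dots,f_n$ in $\mathcal{C}$ there is $\lambda\in\Lambda$ such that every $f_i$ belongs to $\mathcal{U}_\lambda$. Categorical homotopic distance: for functors $F,G\colon\mathcal{C}\to\mathcal{D}$, $\mathrm{cD}(F,G)$ is the least integer $n\ge 0$ such that there is a geometric cover $\{\mathcal{U}_0,\dots,\mathcal{U}_n\}$ of $\mathcal{C}$ with $F_{|\mathcal{U}_j}\simeq G_{|\mathcal{U}_j}$ for all $j$; it is $\infty$ if there is no such cover. *)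

theory Defs
  imports Main "HOL-Library.Extended_Nat"
begin

text \<open>
  Categories are carrier-based: only the values of the operations on the carrier sets \<open>Obj\<close> and
  \<open>Arr\<close> matter. \<open>Comp C g f\<close> is the composite \<open>g \<circ> f\<close>, meaningful when \<open>Cod C f = Dom C g\<close>.
\<close>

record ('o, 'a) cat =
  Obj  :: "'o set"
  Arr  :: "'a set"
  Dom  :: "'a \<Rightarrow> 'o"
  Cod  :: "'a \<Rightarrow> 'o"
  Id   :: "'o \<Rightarrow> 'a"
  Comp :: "'a \<Rightarrow> 'a \<Rightarrow> 'a"

locale small_category =
  fixes C :: "('o, 'a) cat"
  assumes Dom_in: "f \<in> Arr C \<Longrightarrow> Dom C f \<in> Obj C"
    and Cod_in: "f \<in> Arr C \<Longrightarrow> Cod C f \<in> Obj C"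
    and Id_in: "x \<in> Obj C \<Longrightarrow> Id C x \<in> Arr C"
    and Dom_Id: "x \<in> Obj C \<Longrightarrow> Dom C (Id C x) = x"
    and Cod_Id: "x \<in> Obj C \<Longrightarrow> Cod C (Id C x) = x"
    and Comp_in: "\<lbrakk>f \<in> Arr C; g \<in> Arr C; Cod C f = Dom C g\<rbrakk> \<Longrightarrow> Comp C g f \<in> Arr C"
    and Dom_Comp: "\<lbrakk>f \<in> Arr C; g \<in> Arr C; Cod C f = Dom C g\<rbrakk> \<Longrightarrow> Dom C (Comp C g f) = Dom C f"
    and Cod_Comp: "\<lbrakk>f \<in> Arr C; g \<in> Arr C; Cod C f = Dom C g\<rbrakk> \<Longrightarrow> Cod C (Comp C g f) = Cod C g"
    and Comp_Id_right: "f \<in> Arr C \<Longrightarrow> Comp C f (Id C (Dom C f)) = f"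
    and Comp_Id_left: "f \<in> Arr C \<Longrightarrow> Comp C (Id C (Cod C f)) f = f"
    and Comp_assoc: "\<lbrakk>f \<in> Arr C; g \<in> Arr C; h \<in> Arr C; Cod C f = Dom C g; Cod C g = Dom C h\<rbrakk>
      \<Longrightarrow> Comp C h (Comp C g f) = Comp C (Comp C h g) f"

definition arrow_rel :: "('o, 'a) cat \<Rightarrow> ('o \<times> 'o) set" where
  "arrow_rel C = {(Dom C f, Cod C f) | f. f \<in> Arr C}"

text \<open>The empty category counts as connected.\<close>

definition connected_cat :: "('o, 'a) cat \<Rightarrow> bool" where
  "connected_cat C \<longleftrightarrow> (\<forall>x\<in>Obj C. \<forall>y\<in>Obj C. (x, y) \<in> (arrow_rel C \<union> (arrow_rel C)\<inverse>)\<^sup>*)"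

definition subcategory :: "('o, 'a) cat \<Rightarrow> ('o, 'a) cat \<Rightarrow> bool" where
  "subcategory U C \<longleftrightarrow> small_category U \<and> Obj U \<subseteq> Obj C \<and> Arr U \<subseteq> Arr C \<and>
     (\<forall>f\<in>Arr U. Dom U f = Dom C f \<and> Cod U f = Cod C f) \<and>
     (\<forall>x\<in>Obj U. Id U x = Id C x) \<and>
     (\<forall>f\<in>Arr U. \<forall>g\<in>Arr U. Cod C f = Dom C g \<longrightarrow> Comp U g f = Comp C g f)"

record ('o, 'a, 'p, 'b) fctr =
  on_obj :: "'o \<Rightarrow> 'p"
  on_arr :: "'a \<Rightarrow> 'b"

locale is_functor =
  source: small_category C + target: small_category D
  for C :: "('o, 'a) cat" and D :: "('p, 'b) cat" +
  fixes F :: "('o, 'a, 'p, 'b) fctr"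
  assumes on_obj_in: "x \<in> Obj C \<Longrightarrow> on_obj F x \<in> Obj D"
    and on_arr_in: "f \<in> Arr C \<Longrightarrow> on_arr F f \<in> Arr D"
    and on_arr_Dom: "f \<in> Arr C \<Longrightarrow> Dom D (on_arr F f) = on_obj F (Dom C f)"
    and on_arr_Cod: "f \<in> Arr C \<Longrightarrow> Cod D (on_arr F f) = on_obj F (Cod C f)"
    and on_arr_Id: "x \<in> Obj C \<Longrightarrow> on_arr F (Id C x) = Id D (on_obj F x)"
    and on_arr_Comp: "\<lbrakk>f \<in> Arr C; g \<in> Arr C; Cod C f = Dom C g\<rbrakk>
      \<Longrightarrow> on_arr F (Comp C g f) = Comp D (on_arr F g) (on_arr F f)"

text \<open>Equality of functors with source \<open>C\<close>; values outside the carriers of \<open>C\<close> are irrelevant.\<close>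

definition functor_eq ::
  "('o, 'a) cat \<Rightarrow> ('o, 'a, 'p, 'b) fctr \<Rightarrow> ('o, 'a, 'p, 'b) fctr \<Rightarrow> bool" where
  "functor_eq C F G \<longleftrightarrow>
     (\<forall>x\<in>Obj C. on_obj F x = on_obj G x) \<and> (\<forall>f\<in>Arr C. on_arr F f = on_arr G f)"

definition fctr_comp ::
  "('p, 'b, 'q, 'c) fctr \<Rightarrow> ('o, 'a, 'p, 'b) fctr \<Rightarrow> ('o, 'a, 'q, 'c) fctr" where
  "fctr_comp F H = \<lparr>on_obj = on_obj F \<circ> on_obj H, on_arr = on_arr F \<circ> on_arr H\<rparr>"

definition prod_cat :: "('o, 'a) cat \<Rightarrow> ('p, 'b) cat \<Rightarrow> ('o \<times> 'p, 'a \<times> 'b) cat" where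
  "prod_cat C D = \<lparr>
     Obj = Obj C \<times> Obj D,
     Arr = Arr C \<times> Arr D,
     Dom = (\<lambda>(f, g). (Dom C f, Dom D g)),
     Cod = (\<lambda>(f, g). (Cod C f, Cod D g)),
     Id = (\<lambda>(x, y). (Id C x, Id D y)),
     Comp = (\<lambda>(f', g') (f, g). (Comp C f' f, Comp D g' g))\<rparr>"

text \<open>
  The interval category with objects \<open>0, \<dots>, m\<close>. The arrow \<open>r \<rightarrow> s\<close> is encoded as the pair \<open>(r, s)\<close>;
  the case \<open>s = r - 1\<close> is written \<open>r = s + 1\<close> to avoid truncated subtraction at \<open>r = 0\<close>.
\<close>

definition interval_cat :: "nat \<Rightarrow> (nat, nat \<times> nat) cat" where
  "interval_cat m = \<lparr>
     Obj = {0..m},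
     Arr = {(r, s). r \<le> m \<and> s \<le> m \<and> (r = s \<or> (even r \<and> (r = s + 1 \<or> s = r + 1)))},
     Dom = fst,
     Cod = snd,
     Id = (\<lambda>r. (r, r)),
     Comp = (\<lambda>g f. (fst f, snd g))\<rparr>"

lemma small_category_interval_cat: "small_category (interval_cat m)"
  by unfold_locales (auto simp: interval_cat_def)

lemma small_category_prod_cat:
  assumes "small_category C" "small_category D"
  shows "small_category (prod_cat C D)"
proof -
  interpret C: small_category C by fact
  interpret D: small_category D by fact
  show ?thesis
    by unfold_locales
      (auto simp: prod_cat_def C.Dom_in C.Cod_in C.Id_in C.Dom_Id C.Cod_Id C.Comp_in C.Dom_Comp
        C.Cod_Comp C.Comp_Id_right C.Comp_Id_left C.Comp_assoc
        D.Dom_in D.Cod_in D.Id_in D.Dom_Id D.Cod_Id D.Comp_in D.Dom_Comp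
        D.Cod_Comp D.Comp_Id_right D.Comp_Id_left D.Comp_assoc)
qed

text \<open>The functor \<open>H\<^sub>i = H(-, i)\<close> obtained from a functor \<open>H\<close> on \<open>C \<times> I\<^sub>m\<close>.\<close>

definition slice ::
  "('o \<times> nat, 'a \<times> (nat \<times> nat), 'p, 'b) fctr \<Rightarrow> nat \<Rightarrow> ('o, 'a, 'p, 'b) fctr" where
  "slice H i = \<lparr>on_obj = (\<lambda>x. on_obj H (x, i)), on_arr = (\<lambda>f. on_arr H (f, (i, i)))\<rparr>"

definition homotopic ::
  "('o, 'a) cat \<Rightarrow> ('p, 'b) cat \<Rightarrow> ('o, 'a, 'p, 'b) fctr \<Rightarrow> ('o, 'a, 'p, 'b) fctr \<Rightarrow> bool" where
  "homotopic C D F G \<longleftrightarrow>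
     (\<exists>m H. is_functor (prod_cat C (interval_cat m)) D H \<and>
        functor_eq C (slice H 0) F \<and> functor_eq C (slice H m) G)"

text \<open>
  A sequence of composable arrows is a nonempty list \<open>[f\<^sub>1, \<dots>, f\<^sub>n]\<close>, written in the order in which
  the arrows are traversed, i.e. the target of each arrow is the source of the next.
\<close>

definition composable :: "('o, 'a) cat \<Rightarrow> 'a list \<Rightarrow> bool" where
  "composable C fs \<longleftrightarrow>
     fs \<noteq> [] \<and> set fs \<subseteq> Arr C \<and> successively (\<lambda>f g. Cod C f = Dom C g) fs"

definition geometric_cover :: "('o, 'a) cat \<Rightarrow> 'i set \<Rightarrow> ('i \<Rightarrow> ('o, 'a) cat) \<Rightarrow> bool" where
  "geometric_cover C L U \<longleftrightarrow>
     (\<forall>l\<in>L. subcategory (U l) C) \<and>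
     (\<forall>fs. composable C fs \<longrightarrow> (\<exists>l\<in>L. set fs \<subseteq> Arr (U l)))"

text \<open>
  The restriction of \<open>F\<close> to a subcategory \<open>U\<close> is \<open>F\<close> itself with \<open>U\<close> as its source category.
  If there is no suitable cover, the infimum is \<open>Inf {} = \<infinity>\<close> in \<open>enat\<close>.
\<close>

definition cD ::
  "('o, 'a) cat \<Rightarrow> ('p, 'b) cat \<Rightarrow> ('o, 'a, 'p, 'b) fctr \<Rightarrow> ('o, 'a, 'p, 'b) fctr \<Rightarrow> enat" where
  "cD C D F G = Inf {enat n | n. \<exists>U. geometric_cover C {0..n} U \<and>
     (\<forall>j\<in>{0..n}. homotopic (U j) D F G)}"

end

theory Submission
  imports Defs
begin

text \<open>
  Every cover that witnesses the distance of \<open>F\<close> and \<open>G\<close> can be pulled back along \<open>H\<close> without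
  changing the number of its members. The preimages under \<open>H\<close> of the members of a geometric cover
  of \<open>C\<close> form a geometric cover of \<open>E\<close>, because \<open>H\<close> carries a composable sequence of \<open>E\<close> to a
  composable sequence of \<open>C\<close>, and the latter lies in a single member
  (\<open>geometric_cover_preimage\<close>). On the preimage \<open>V\<close> of a
  member \<open>U\<close>, \<open>H\<close> restricts to a functor \<open>V \<rightarrow> U\<close>, so a homotopy \<open>K: U \<times> I\<^sub>m \<rightarrow> D\<close> from \<open>F\<close> to \<open>G\<close>
  gives the homotopy \<open>K \<circ> (H \<times> id): V \<times> I\<^sub>m \<rightarrow> D\<close> from \<open>F \<circ> H\<close> to \<open>G \<circ> H\<close>
  (\<open>homotopic_comp_right\<close>). Hence every \<open>n\<close> that is admissible for \<open>cD C D F G\<close> is admissible for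
  the composites, and the infima compare.
\<close>

lemma is_functor_id:
  assumes "small_category C"
  shows "is_functor C C \<lparr>on_obj = (\<lambda>x. x), on_arr = (\<lambda>f. f)\<rparr>"
  using assms by (simp add: is_functor_def is_functor_axioms_def)

lemma is_functor_comp:
  assumes "is_functor B C H" and "is_functor C D F"
  shows "is_functor B D (fctr_comp F H)"
proof -
  interpret H: is_functor B C H by fact
  interpret F: is_functor C D F by fact
  show ?thesis
    by unfold_locales
      (auto simp: fctr_comp_def H.on_obj_in H.on_arr_in H.on_arr_Dom H.on_arr_Cod H.on_arr_Id
        H.on_arr_Comp F.on_obj_in F.on_arr_in F.on_arr_Dom F.on_arr_Cod F.on_arr_Id F.on_arr_Comp)
qed

definition prod_fctr ::
  "('o, 'a, 'p, 'b) fctr \<Rightarrow> ('q, 'c, 'r, 'd) fctr \<Rightarrow> ('o \<times> 'q, 'a \<times> 'c, 'p \<times> 'r, 'b \<times> 'd) fctr"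
  where
  "prod_fctr F G =
     \<lparr>on_obj = map_prod (on_obj F) (on_obj G), on_arr = map_prod (on_arr F) (on_arr G)\<rparr>"

lemma is_functor_prod:
  assumes "is_functor A C F" and "is_functor B D G"
  shows "is_functor (prod_cat A B) (prod_cat C D) (prod_fctr F G)"
proof -
  interpret F: is_functor A C F by fact
  interpret G: is_functor B D G by fact
  have "small_category (prod_cat A B)" "small_category (prod_cat C D)"
    by (simp_all add: small_category_prod_cat F.source.small_category_axioms
        F.target.small_category_axioms G.source.small_category_axioms
        G.target.small_category_axioms)
  moreover have "is_functor_axioms (prod_cat A B) (prod_cat C D) (prod_fctr F G)"
    by unfold_locales
      (auto simp: prod_cat_def prod_fctr_def
        F.on_obj_in F.on_arr_in F.on_arr_Dom F.on_arr_Cod F.on_arr_Id F.on_arr_Comp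
        G.on_obj_in G.on_arr_in G.on_arr_Dom G.on_arr_Cod G.on_arr_Id G.on_arr_Comp)
  ultimately show ?thesis
    by (simp add: is_functor_def)
qed

text \<open>
  Precomposition of a homotopy \<open>K\<close> with \<open>H \<times> id\<close> acts on each slice as precomposition with \<open>H\<close>, in
  particular on the two ends.
\<close>

lemma homotopic_comp_right:
  assumes H: "is_functor V U H" and FG: "homotopic U D F G"
  shows "homotopic V D (fctr_comp F H) (fctr_comp G H)"
proof -
  interpret H: is_functor V U H by fact
  obtain m K where K: "is_functor (prod_cat U (interval_cat m)) D K"
    and ends: "functor_eq U (slice K 0) F" "functor_eq U (slice K m) G"
    using FG unfolding homotopic_def by blast
  let ?K' = "fctr_comp K (prod_fctr H \<lparr>on_obj = (\<lambda>i. i), on_arr = (\<lambda>f. f)\<rparr>)"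
  have "is_functor (prod_cat V (interval_cat m)) D ?K'"
    by (intro is_functor_comp[OF _ K] is_functor_prod H is_functor_id small_category_interval_cat)
  moreover have "functor_eq V (slice ?K' 0) (fctr_comp F H)"
    "functor_eq V (slice ?K' m) (fctr_comp G H)"
    using ends
    by (auto simp: functor_eq_def slice_def fctr_comp_def prod_fctr_def
        H.on_obj_in H.on_arr_in)
  ultimately show ?thesis
    unfolding homotopic_def by blast
qed

text \<open>
  A subcategory \<open>U\<close> need not be full, so an arrow has to be tested itself and not only its ends.
\<close>

definition preimage_cat ::
  "('o, 'a) cat \<Rightarrow> ('o, 'a, 'p, 'b) fctr \<Rightarrow> ('p, 'b) cat \<Rightarrow> ('o, 'a) cat" where
  "preimage_cat E H U = E\<lparr>
     Obj := {x \<in> Obj E. on_obj H x \<in> Obj U},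
     Arr := {f \<in> Arr E. on_arr H f \<in> Arr U}\<rparr>"

context is_functor
begin

context
  fixes U
  assumes U: "subcategory U D"
begin

interpretation U: small_category U
  using U by (simp add: subcategory_def)

private lemma U_ops:
  "f \<in> Arr U \<Longrightarrow> Dom U f = Dom D f" "f \<in> Arr U \<Longrightarrow> Cod U f = Cod D f"
  "x \<in> Obj U \<Longrightarrow> Id U x = Id D x"
  "\<lbrakk>f \<in> Arr U; g \<in> Arr U; Cod D f = Dom D g\<rbrakk> \<Longrightarrow> Comp U g f = Comp D g f"
  using U by (auto simp: subcategory_def)

text \<open>
  The preimage is closed under the operations of the source category since \<open>U\<close> is closed under
  those of the target, which agree with its own.
\<close>

lemma small_category_preimage: "small_category (preimage_cat C F U)"
proof -
  have "on_obj F (Dom C f) \<in> Obj U" "on_obj F (Cod C f) \<in> Obj U"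
    if "f \<in> Arr C" "on_arr F f \<in> Arr U" for f
    using that U.Dom_in[of "on_arr F f"] U.Cod_in[of "on_arr F f"]
    by (simp_all add: U_ops on_arr_Dom on_arr_Cod)
  moreover have "on_arr F (Id C x) \<in> Arr U" if "x \<in> Obj C" "on_obj F x \<in> Obj U" for x
    using that U.Id_in[of "on_obj F x"] by (simp add: U_ops on_arr_Id)
  moreover have "on_arr F (Comp C g f) \<in> Arr U"
    if "f \<in> Arr C" "g \<in> Arr C" "on_arr F f \<in> Arr U" "on_arr F g \<in> Arr U" "Cod C f = Dom C g"
    for f g
    using that U.Comp_in[of "on_arr F f" "on_arr F g"]
    by (simp add: U_ops on_arr_Comp on_arr_Dom on_arr_Cod)
  ultimately show ?thesis
    by unfold_locales
      (auto simp: preimage_cat_def source.Dom_in source.Cod_in source.Id_in source.Dom_Id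
        source.Cod_Id source.Comp_in source.Dom_Comp source.Cod_Comp source.Comp_Id_right
        source.Comp_Id_left source.Comp_assoc)
qed

lemma subcategory_preimage: "subcategory (preimage_cat C F U) C"
  unfolding subcategory_def using small_category_preimage by (auto simp: preimage_cat_def)

lemma is_functor_preimage: "is_functor (preimage_cat C F U) U F"
proof -
  have "is_functor_axioms (preimage_cat C F U) U F"
    by unfold_locales
      (auto simp: preimage_cat_def U_ops on_arr_Dom on_arr_Cod on_arr_Id on_arr_Comp)
  then show ?thesis
    by (simp add: is_functor_def small_category_preimage U.small_category_axioms)
qed

end

lemma composable_map:
  assumes "composable C fs"
  shows "composable D (map (on_arr F) fs)"
proof -
  have "successively (\<lambda>f g. Dom D (on_arr F g) = Cod D (on_arr F f)) fs"
    using assms unfolding composable_def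
    by (auto elim!: successively_mono simp: on_arr_Dom on_arr_Cod subset_iff)
  then show ?thesis
    using assms by (auto simp: composable_def successively_map on_arr_in eq_commute)
qed

lemma geometric_cover_preimage:
  assumes "geometric_cover D L U"
  shows "geometric_cover C L (\<lambda>l. preimage_cat C F (U l))"
  unfolding geometric_cover_def
proof (intro conjI allI impI ballI)
  show "subcategory (preimage_cat C F (U l)) C" if "l \<in> L" for l
    using assms that by (simp add: geometric_cover_def subcategory_preimage)
next
  fix fs assume fs: "composable C fs"
  then obtain l where "l \<in> L" "set (map (on_arr F) fs) \<subseteq> Arr (U l)"
    using assms composable_map[OF fs] unfolding geometric_cover_def by blast
  with fs show "\<exists>l\<in>L. set fs \<subseteq> Arr (preimage_cat C F (U l))"
    by (auto simp: preimage_cat_def composable_def)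
qed

end

theorem proposition4p3:
  fixes C :: "('o1, 'a1) cat" and D :: "('o2, 'a2) cat" and E :: "('o3, 'a3) cat"
    and F G :: "('o1, 'a1, 'o2, 'a2) fctr" and H :: "('o3, 'a3, 'o1, 'a1) fctr"
  assumes "small_category C" and "connected_cat C"
    and "small_category D" and "connected_cat D"
    and "small_category E" and "connected_cat E"
    and "is_functor C D F" and "is_functor C D G" and "is_functor E C H"
  shows "cD E D (fctr_comp F H) (fctr_comp G H) \<le> cD C D F G"
proof -
  interpret H: is_functor E C H by fact
  have "\<exists>V. geometric_cover E {0..n} V \<and>
      (\<forall>j\<in>{0..n}. homotopic (V j) D (fctr_comp F H) (fctr_comp G H))"
    if U: "geometric_cover C {0..n} U" "\<forall>j\<in>{0..n}. homotopic (U j) D F G" for n and U :: "nat \<Rightarrow> _"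
  proof (intro exI conjI ballI)
    show "geometric_cover E {0..n} (\<lambda>j. preimage_cat E H (U j))"
      using U(1) by (rule H.geometric_cover_preimage)
  next
    fix j assume "j \<in> {0..n}"
    with U show "homotopic (preimage_cat E H (U j)) D (fctr_comp F H) (fctr_comp G H)"
      by (auto simp: geometric_cover_def intro!: homotopic_comp_right H.is_functor_preimage)
  qed
  then show ?thesis
    unfolding cD_def by (intro Inf_superset_mono) blast
qed

end
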